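(* Let $n\geq 4$ be an even integer, $k\geq 3$ and $m\geq 2$ integers. Then the minimum size of a resolving set of vertices of $(C_n\Box P_k)\Box P_m$ is $4$, i.e. $\beta((C_n\Box P_k)\Box P_m)=4$.
   Context: $C_n$ denotes the cycle on $n$ vertices and $P_k$, $P_m$ the paths on $k$ and $m$ vertices. For graphs $G,H$, the Cartesian product $G\Box H$ has vertex set $V(G)\times V(H)$, with $(g_1,h_1)$ adjacent to $(g_2,h_2)$ iff either $h_1=h_2$ and $g_1g_2\in E(G)$, or $g_1=g_2$ and $h_1h_2\in E(H)$. For a connected graph $G$ and an ordered set $Q=\{q_1,\dots,q_l\}\subseteq V(G)$, $r(x|Q)=(d(x,q_1),\dots,d(x,q_l))$, where $d$ is the shortest-path distance. $Q$ is a resolving set if distinct vertices have distinct representations $r(\cdot|Q)$. $\beta(G)$ is the minimum size of a resolving set of $G$. *)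

theory Defs
  imports "Graph_Theory.Graph_Theory"
begin

text \<open>
  Undirected simple graphs are those satisfying \<^locale>\<open>pair_graph\<close>: finite symmetric
  irreflexive arc sets, where an edge is represented by its two orientations.
\<close>

text \<open>The arcs below form a simple cycle only for \<open>n \<ge> 3\<close>.\<close>

definition cycle_graph :: "nat \<Rightarrow> nat pair_pre_digraph" where
  "cycle_graph n =
     \<lparr> pverts = {..<n},
       parcs = {(i, j). i < n \<and> j < n \<and> (j = (i + 1) mod n \<or> i = (j + 1) mod n)} \<rparr>"

text \<open>The index is the number of vertices, not the number of edges.\<close>

definition path_graph :: "nat \<Rightarrow> nat pair_pre_digraph" where
  "path_graph k =
     \<lparr> pverts = {..<k},
       parcs = {(i, j). i < k \<and> j < k \<and> (j = i + 1 \<or> i = j + 1)} \<rparr>"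

definition cartesian_product ::
    "'a pair_pre_digraph \<Rightarrow> 'b pair_pre_digraph \<Rightarrow> ('a \<times> 'b) pair_pre_digraph"
    (infixl \<open>\<box>\<close> 70) where
  "G \<box> H =
     \<lparr> pverts = pverts G \<times> pverts H,
       parcs = {((g1, h1), (g2, h2)).
                  (h1 = h2 \<and> h1 \<in> pverts H \<and> (g1, g2) \<in> parcs G) \<or>
                  (g1 = g2 \<and> g1 \<in> pverts G \<and> (h1, h2) \<in> parcs H)} \<rparr>"

text \<open>
  Every arc has weight 1, so the cost of a walk is its length. Distances are extended reals
  because the infimum over an empty set of walks is infinite; in a connected graph all
  distances are natural numbers.
\<close>

definition graph_dist :: "'a pair_pre_digraph \<Rightarrow> 'a \<Rightarrow> 'a \<Rightarrow> ereal" where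
  "graph_dist G u v = wf_digraph.\<mu> (with_proj G) (\<lambda>_. 1) u v"

text \<open>An ordered set of vertices is a list without repetitions.\<close>

definition representation :: "'a pair_pre_digraph \<Rightarrow> 'a \<Rightarrow> 'a list \<Rightarrow> ereal list" where
  "representation G x Q = map (graph_dist G x) Q"

definition resolving_set :: "'a pair_pre_digraph \<Rightarrow> 'a list \<Rightarrow> bool" where
  "resolving_set G Q \<longleftrightarrow>
     distinct Q \<and> set Q \<subseteq> pverts G \<and>
     (\<forall>x\<in>pverts G. \<forall>y\<in>pverts G. x \<noteq> y \<longrightarrow> representation G x Q \<noteq> representation G y Q)"

definition metric_dimension :: "'a pair_pre_digraph \<Rightarrow> nat" where
  "metric_dimension G = (LEAST l. \<exists>Q. resolving_set G Q \<and> length Q = l)"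

lemma pair_graph_cycle_graph: "n \<ge> 3 \<Longrightarrow> pair_graph (cycle_graph n)"
proof unfold_locales
  assume n: "n \<ge> 3"
  show "finite (parcs (cycle_graph n))"
    by (rule finite_subset[of _ "{..<n} \<times> {..<n}"]) (auto simp: cycle_graph_def)
  show "symmetric (with_proj (cycle_graph n))"
    by (auto simp: cycle_graph_def symmetric_def sym_def)
  show "fst e \<noteq> snd e" if "e \<in> parcs (cycle_graph n)" for e
    using that n by (auto simp: cycle_graph_def mod_Suc split: if_splits)
qed (auto simp: cycle_graph_def)

lemma pair_graph_path_graph: "pair_graph (path_graph k)"
proof unfold_locales
  show "finite (parcs (path_graph k))"
    by (rule finite_subset[of _ "{..<k} \<times> {..<k}"]) (auto simp: path_graph_def)
  show "symmetric (with_proj (path_graph k))"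
    by (auto simp: path_graph_def symmetric_def sym_def)
qed (auto simp: path_graph_def)

lemma pair_graph_cartesian_product:
  assumes "pair_graph G" "pair_graph H"
  shows "pair_graph (G \<box> H)"
proof -
  interpret G: pair_graph G by fact
  interpret H: pair_graph H by fact
  have verts: "parcs (G \<box> H) \<subseteq> (pverts G \<times> pverts H) \<times> (pverts G \<times> pverts H)"
    by (auto simp: cartesian_product_def dest: G.wellformed' H.wellformed')
  have "sym (parcs G)" "sym (parcs H)"
    using G.pair_sym_arcs H.pair_sym_arcs by (simp_all add: symmetric_def)
  then have symmetric: "symmetric (with_proj (G \<box> H))"
    by (auto simp: cartesian_product_def symmetric_def sym_def)
  show ?thesis
  proof unfold_locales
    show "finite (pverts (G \<box> H))"
      by (simp add: cartesian_product_def G.pair_finite_verts H.pair_finite_verts)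
    show "finite (parcs (G \<box> H))"
      by (rule finite_subset[OF verts]) (simp add: G.pair_finite_verts H.pair_finite_verts)
    show "symmetric (with_proj (G \<box> H))" by (rule symmetric)
    show "fst e \<noteq> snd e" if "e \<in> parcs (G \<box> H)" for e
      using that G.pair_no_loops H.pair_no_loops
      by (fastforce simp: cartesian_product_def)
    show "fst e \<in> pverts (G \<box> H)" "snd e \<in> pverts (G \<box> H)" if "e \<in> parcs (G \<box> H)" for e
      using that by (auto simp: cartesian_product_def dest: G.wellformed' H.wellformed')
  qed
qed

lemma graph_dist_eq:
  assumes "pair_graph G"
  shows "graph_dist G u v =
    (INF p\<in>{p. pre_digraph.awalk (with_proj G) u p v}. ereal (real (length p)))"
proof -
  interpret pair_graph G by fact
  have "awalk_cost (\<lambda>_. 1) p = real (length p)" for p :: "('a \<times> 'a) list"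
    by (induction p) (simp_all add: awalk_cost_def)
  then show ?thesis
    by (simp add: graph_dist_def \<mu>_def)
qed

end

theory Submission
  imports Defs
begin

text \<open>
  Fix three vertices of a product \<open>G \<box> H1 \<box> H2\<close> of connected bipartite graphs, where \<open>G\<close> has
  minimum degree at least 2 and \<open>H1\<close>, \<open>H2\<close> have an edge. Traversing an edge of a factor changes
  each of the three distances by \<open>\<plusminus>1\<close>, giving a sign vector. If edges of two different factors
  have the same sign vector up to a global sign, two vertices of the square they span are not
  resolved. Fix an edge of \<open>H1\<close> and one of \<open>H2\<close>, with sign vectors \<open>u\<close> and \<open>w\<close>; after reordering
  \<open>u\<^sub>1 u\<^sub>2 = w\<^sub>1 w\<^sub>2\<close>, since the three products of pairs multiply to 1 on both sides. If \<open>u \<noteq> \<plusminus>w\<close>,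
  every edge of \<open>G\<close> whose first two signs have product \<open>u\<^sub>1 u\<^sub>2\<close> is parallel to \<open>u\<close> or \<open>w\<close>. Hence
  two neighbours \<open>p\<close>, \<open>p'\<close> of the \<open>G\<close>-coordinate of the first vertex agree in the first two
  distances, and they differ by 0 or \<open>\<plusminus>2\<close> in the third, which a diagonal step of
  \<open>H1 \<box> H2\<close> compensates. So three vertices never resolve. Conversely, the four
  vertices \<open>(0,0,0)\<close>, \<open>(1,0,0)\<close>, \<open>(0,k-1,0)\<close>, \<open>(0,0,m-1)\<close> resolve: the first with the third and
  with the fourth determines the path coordinates, and a vertex of an even cycle is determined by
  its distances to 0 and 1.
\<close>

section \<open>Distance functions of connected bipartite graphs\<close>

text \<open>Three local conditions that force \<open>d\<close> to be the shortest-path distance, so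
  an explicit formula can be verified one arc at a time. As \<open>dist_arc\<close> forbids equal
  distances at the two ends of an arc, the graph is bipartite; \<open>dist_closer\<close> makes it
  connected.\<close>

locale bipartite_distance = pair_graph G for G :: "'a pair_pre_digraph" +
  fixes d :: "'a \<Rightarrow> 'a \<Rightarrow> nat"
  assumes dist_eq_0_iff: "u \<in> pverts G \<Longrightarrow> v \<in> pverts G \<Longrightarrow> d u v = 0 \<longleftrightarrow> u = v"
    and dist_arc: "(u, v) \<in> parcs G \<Longrightarrow> w \<in> pverts G \<Longrightarrow>
      d u w = Suc (d v w) \<or> d v w = Suc (d u w)"
    and dist_closer: "u \<in> pverts G \<Longrightarrow> w \<in> pverts G \<Longrightarrow> u \<noteq> w \<Longrightarrow>
      \<exists>v. (u, v) \<in> parcs G \<and> d u w = Suc (d v w)"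
begin

lemma dist_le_length:
  assumes "awalk u p w"
  shows "d u w \<le> length p"
  using assms
proof (induction p arbitrary: u)
  case Nil
  then show ?case by (auto simp: awalk_Nil_iff dist_eq_0_iff)
next
  case (Cons e p)
  then have "e \<in> parcs G" "u = fst e" "awalk (snd e) p w"
    by (auto simp: awalk_Cons_iff)
  moreover from this have "w \<in> pverts G" by auto
  ultimately show ?case
    using Cons.IH[of "snd e"] dist_arc[of u "snd e" w] by fastforce
qed

text \<open>Greedy descent: \<open>dist_closer\<close> supplies arcs that each bring the walk one
  unit nearer to \<open>w\<close>.\<close>

lemma shortest_walk:
  assumes "u \<in> pverts G" "w \<in> pverts G"
  shows "\<exists>p. awalk u p w \<and> length p = d u w"
  using assms
proof (induction "d u w" arbitrary: u)
  case 0
  then show ?case by (intro exI[of _ "[]"]) (auto simp: awalk_Nil_iff dist_eq_0_iff)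
next
  case (Suc l)
  then have "u \<noteq> w" using dist_eq_0_iff by fastforce
  then obtain v where v: "(u, v) \<in> parcs G" "d u w = Suc (d v w)"
    using dist_closer Suc.prems by blast
  moreover have "v \<in> pverts G" using v by (auto dest: wellformed')
  ultimately obtain p where "awalk v p w" "length p = d v w"
    using Suc by force
  then show ?case
    using v by (intro exI[of _ "(u, v) # p"]) (simp add: awalk_Cons_iff)
qed

lemma graph_dist_conv:
  assumes "u \<in> pverts G" "w \<in> pverts G"
  shows "graph_dist G u w = ereal (real (d u w))"
proof -
  obtain p where "awalk u p w" "length p = d u w" using shortest_walk assms by blast
  then have "(INF p\<in>{p. awalk u p w}. ereal (real (length p))) \<le> ereal (real (d u w))"
    by (intro INF_lower2[of p]) auto
  moreover have "ereal (real (d u w)) \<le> (INF p\<in>{p. awalk u p w}. ereal (real (length p)))"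
    by (intro INF_greatest) (simp add: dist_le_length)
  ultimately show ?thesis by (simp add: graph_dist_eq[OF pair_graph_axioms])
qed

lemma representation_eq_iff:
  assumes "x \<in> pverts G" "y \<in> pverts G" "set Q \<subseteq> pverts G"
  shows "representation G x Q = representation G y Q \<longleftrightarrow> (\<forall>q\<in>set Q. d x q = d y q)"
  using assms by (auto simp: representation_def graph_dist_conv subset_iff)

end

text \<open>An arc of the product moves one coordinate, so exactly one summand changes, by one. To
  come closer to a target, move in a coordinate that still differs from it.\<close>

lemma bipartite_distance_cartesian_product:
  assumes "bipartite_distance G d" "bipartite_distance H e"
  shows "bipartite_distance (G \<box> H) (\<lambda>(g, h) (g', h'). d g g' + e h h')"
proof -
  interpret G: bipartite_distance G d by fact
  interpret H: bipartite_distance H e by fact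
  interpret GH: pair_graph "G \<box> H"
    by (rule pair_graph_cartesian_product) unfold_locales
  show ?thesis
  proof unfold_locales
    fix x y assume "x \<in> pverts (G \<box> H)" "y \<in> pverts (G \<box> H)"
    then show "(case x of (g, h) \<Rightarrow> \<lambda>(g', h'). d g g' + e h h') y = 0 \<longleftrightarrow> x = y"
      by (auto simp: cartesian_product_def G.dist_eq_0_iff H.dist_eq_0_iff)
  next
    fix x y z assume "(x, y) \<in> parcs (G \<box> H)" "z \<in> pverts (G \<box> H)"
    then show "(case x of (g, h) \<Rightarrow> \<lambda>(g', h'). d g g' + e h h') z =
        Suc ((case y of (g, h) \<Rightarrow> \<lambda>(g', h'). d g g' + e h h') z) \<or>
      (case y of (g, h) \<Rightarrow> \<lambda>(g', h'). d g g' + e h h') z =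
        Suc ((case x of (g, h) \<Rightarrow> \<lambda>(g', h'). d g g' + e h h') z)"
      by (auto simp: cartesian_product_def dest: G.dist_arc H.dist_arc)
  next
    fix x z assume xz: "x \<in> pverts (G \<box> H)" "z \<in> pverts (G \<box> H)" "x \<noteq> z"
    obtain g h g' h' where eq: "x = (g, h)" "z = (g', h')" by fastforce
    have V: "g \<in> pverts G" "g' \<in> pverts G" "h \<in> pverts H" "h' \<in> pverts H"
      using xz eq by (auto simp: cartesian_product_def)
    show "\<exists>y. (x, y) \<in> parcs (G \<box> H) \<and>
      (case x of (g, h) \<Rightarrow> \<lambda>(g', h'). d g g' + e h h') z =
        Suc ((case y of (g, h) \<Rightarrow> \<lambda>(g', h'). d g g' + e h h') z)"
    proof (cases "g = g'")
      case True
      then obtain k where "(h, k) \<in> parcs H" "e h h' = Suc (e k h')"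
        using H.dist_closer V xz eq by blast
      then show ?thesis
        using V eq by (intro exI[of _ "(g, k)"]) (simp add: cartesian_product_def)
    next
      case False
      then obtain k where "(g, k) \<in> parcs G" "d g g' = Suc (d k g')"
        using G.dist_closer V by blast
      then show ?thesis
        using V eq by (intro exI[of _ "(k, h)"]) (simp add: cartesian_product_def)
    qed
  qed
qed

section \<open>Three vertices do not resolve\<close>

text \<open>The arithmetic core, free of graphs: index i of \<open>f\<close>, \<open>y\<close>,
  \<open>z\<close> stands for the distances to the i-th chosen vertex in the three factors. In the
  application \<open>g\<close> is the first vertex's own coordinate, so \<open>f1\<close> is 1 at
  both neighbours \<open>p\<close> and \<open>p'\<close>.\<close>

lemma unresolved_if_two_signs_agree:
  fixes f1 f2 f3 :: "'a \<Rightarrow> int" and y1 y2 y3 :: "'b \<Rightarrow> int" and z1 z2 z3 :: "'c \<Rightarrow> int"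
  assumes ne: "p \<noteq> p'" "p \<noteq> g" "p' \<noteq> g" "h \<noteq> h'" "l \<noteq> l'"
    and y: "y1 h' - y1 h \<in> {1, -1}" "y2 h' - y2 h \<in> {1, -1}" "y3 h' - y3 h \<in> {1, -1}"
    and z: "z1 l' - z1 l \<in> {1, -1}" "z2 l' - z2 l \<in> {1, -1}" "z3 l' - z3 l \<in> {1, -1}"
    and f: "f1 p - f1 g \<in> {1, -1}" "f2 p - f2 g \<in> {1, -1}" "f3 p - f3 g \<in> {1, -1}"
    and f': "f1 p' = f1 p" "f2 p' - f2 g \<in> {1, -1}" "f3 p' - f3 g \<in> {1, -1}"
    and yz: "(y1 h' - y1 h) * (y2 h' - y2 h) = (z1 l' - z1 l) * (z2 l' - z2 l)"
  shows "\<exists>x\<in>{g, p, p'} \<times> {h, h'} \<times> {l, l'}. \<exists>x'\<in>{g, p, p'} \<times> {h, h'} \<times> {l, l'}. x \<noteq> x' \<and>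
    (\<forall>(f, y, z)\<in>{(f1, y1, z1), (f2, y2, z2), (f3, y3, z3)}.
      f (fst x) + y (fst (snd x)) + z (snd (snd x)) =
      f (fst x') + y (fst (snd x')) + z (snd (snd x')))"
    (is ?thesis)
proof -
  have collision: ?thesis
    if "a \<in> {g, p, p'}" "b \<in> {h, h'}" "c \<in> {l, l'}" "a' \<in> {g, p, p'}" "b' \<in> {h, h'}" "c' \<in> {l, l'}"
      "(a, b, c) \<noteq> (a', b', c')" "f1 a + y1 b + z1 c = f1 a' + y1 b' + z1 c'"
      "f2 a + y2 b + z2 c = f2 a' + y2 b' + z2 c'" "f3 a + y3 b + z3 c = f3 a' + y3 b' + z3 c'"
    for a b c a' b' c'
  proof -
    have 1: "(a, b, c) \<in> {g, p, p'} \<times> {h, h'} \<times> {l, l'}" using that(1-3) by blast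
    have 2: "(a', b', c') \<in> {g, p, p'} \<times> {h, h'} \<times> {l, l'}" using that(4-6) by blast
    have 3: "(a, b, c) \<noteq> (a', b', c') \<and> (\<forall>(f, y, z)\<in>{(f1, y1, z1), (f2, y2, z2), (f3, y3, z3)}.
        f (fst (a, b, c)) + y (fst (snd (a, b, c))) + z (snd (snd (a, b, c))) =
        f (fst (a', b', c')) + y (fst (snd (a', b', c'))) + z (snd (snd (a', b', c'))))"
      using that(7-10) by simp
    show ?thesis by (rule bexI[OF _ 1], rule bexI[OF _ 2], rule 3)
  qed
  define par :: "int \<Rightarrow> int \<Rightarrow> int \<Rightarrow> int \<Rightarrow> int \<Rightarrow> int \<Rightarrow> bool" where
    "par r1 r2 r3 s1 s2 s3 \<longleftrightarrow> r1 = s1 \<and> r2 = s2 \<and> r3 = s3 \<or> r1 = -s1 \<and> r2 = -s2 \<and> r3 = -s3"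
    for r1 r2 r3 s1 s2 s3
  define u1 u2 u3 where u: "u1 = y1 h' - y1 h" "u2 = y2 h' - y2 h" "u3 = y3 h' - y3 h"
  define w1 w2 w3 where w: "w1 = z1 l' - z1 l" "w2 = z2 l' - z2 l" "w3 = z3 l' - z3 l"
  \<comment> \<open>In a square spanned by two parallel edges the two steps cancel along one
    diagonal; the global sign decides which one.\<close>
  have uw: ?thesis if "par u1 u2 u3 w1 w2 w3"
    using that unfolding par_def
  proof
    assume "u1 = w1 \<and> u2 = w2 \<and> u3 = w3"
    then show ?thesis by (intro collision[of g h' l g h l']) (use ne u w in auto)
  next
    assume "u1 = -w1 \<and> u2 = -w2 \<and> u3 = -w3"
    then show ?thesis by (intro collision[of g h' l' g h l]) (use ne u w in auto)
  qed
  have fu: ?thesis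
    if "q \<in> {p, p'}" "par (f1 q - f1 g) (f2 q - f2 g) (f3 q - f3 g) u1 u2 u3" for q
    using that(2) unfolding par_def
  proof
    assume "f1 q - f1 g = u1 \<and> f2 q - f2 g = u2 \<and> f3 q - f3 g = u3"
    then show ?thesis by (intro collision[of q h l g h' l]) (use ne u that in auto)
  next
    assume "f1 q - f1 g = -u1 \<and> f2 q - f2 g = -u2 \<and> f3 q - f3 g = -u3"
    then show ?thesis by (intro collision[of q h' l g h l]) (use ne u that in auto)
  qed
  have fw: ?thesis
    if "q \<in> {p, p'}" "par (f1 q - f1 g) (f2 q - f2 g) (f3 q - f3 g) w1 w2 w3" for q
    using that(2) unfolding par_def
  proof
    assume "f1 q - f1 g = w1 \<and> f2 q - f2 g = w2 \<and> f3 q - f3 g = w3"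
    then show ?thesis by (intro collision[of q h l g h l']) (use ne w that in auto)
  next
    assume "f1 q - f1 g = -w1 \<and> f2 q - f2 g = -w2 \<and> f3 q - f3 g = -w3"
    then show ?thesis by (intro collision[of q h l' g h l]) (use ne w that in auto)
  qed
  have signs: "u1 = 1 \<or> u1 = -1" "u2 = 1 \<or> u2 = -1" "u3 = 1 \<or> u3 = -1"
    "w1 = 1 \<or> w1 = -1" "w2 = 1 \<or> w2 = -1" "w3 = 1 \<or> w3 = -1"
    using y z by (auto simp: u w)
  have uw12: "u1 * u2 = w1 * w2" using yz by (simp add: u w)
  \<comment> \<open>Equal products of the first two signs make these pairs parallel, so only the
    third sign can break parallelism.\<close>
  have opposite: "w1 = u1 \<and> w2 = u2 \<and> w3 = -u3 \<or> w1 = -u1 \<and> w2 = -u2 \<and> w3 = u3"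
    if "\<not> par u1 u2 u3 w1 w2 w3"
  proof -
    have "w1 = u1 \<and> w2 = u2 \<or> w1 = -u1 \<and> w2 = -u2"
      using uw12 signs(1,2,4,5) by (elim disjE) simp_all
    moreover have "w3 = u3 \<or> w3 = -u3" using signs(3,6) by auto
    ultimately show ?thesis using that unfolding par_def by auto
  qed
  \<comment> \<open>Up to a global sign only two sign vectors have a given product of their first
    two entries; \<open>u\<close> and \<open>w\<close> are these two.\<close>
  have third: "par s1 s2 s3 u1 u2 u3 \<or> par s1 s2 s3 w1 w2 w3"
    if s: "s1 \<in> {1, -1}" "s2 \<in> {1, -1}" "s3 \<in> {1, -1}" "s1 * s2 = u1 * u2"
      and "\<not> par u1 u2 u3 w1 w2 w3" for s1 s2 s3
  proof -
    have w: "w1 = u1 \<and> w2 = u2 \<and> w3 = -u3 \<or> w1 = -u1 \<and> w2 = -u2 \<and> w3 = u3"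
      by (rule opposite) fact
    have "s1 = u1 \<and> s2 = u2 \<or> s1 = -u1 \<and> s2 = -u2"
      using s(1,2,4) signs(1,2) unfolding insert_iff empty_iff by (elim disjE) simp_all
    moreover have "s3 = u3 \<or> s3 = -u3" using s(3) signs(3) by auto
    ultimately show ?thesis using w unfolding par_def by (elim disjE conjE) simp_all
  qed
  consider "par u1 u2 u3 w1 w2 w3"
    | q where "q \<in> {p, p'}" "(f1 q - f1 g) * (f2 q - f2 g) = u1 * u2" "\<not> par u1 u2 u3 w1 w2 w3"
    | "(f1 p - f1 g) * (f2 p - f2 g) \<noteq> u1 * u2" "(f1 p' - f1 g) * (f2 p' - f2 g) \<noteq> u1 * u2"
      "\<not> par u1 u2 u3 w1 w2 w3"
    by blast
  then show ?thesis
  proof cases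
    case 1
    then show ?thesis by (rule uw)
  next
    case (2 q)
    have "par (f1 q - f1 g) (f2 q - f2 g) (f3 q - f3 g) u1 u2 u3 \<or>
        par (f1 q - f1 g) (f2 q - f2 g) (f3 q - f3 g) w1 w2 w3"
      by (rule third) (use 2 f f' in \<open>fastforce+\<close>)
    then show ?thesis using fu fw 2 by blast
  next
    case 3
    \<comment> \<open>Both products are the sign other than \<open>u1 * u2\<close>, hence equal; the
      first factors agree, so the second ones do.\<close>
    have f2: "f2 p' = f2 p"
      using 3(1,2) f(1,2) f'(1,2) signs(1,2) by auto
    \<comment> \<open>Two signs differ by 0 or by plus or minus 2. By \<open>opposite\<close>, a
      diagonal step in the other two factors can keep the first two distances and shift the third by
      2 in either direction, which offsets the difference.\<close>
    consider "f3 p = f3 p'" | "f3 p - f3 p' = 2 * u3" | "f3 p - f3 p' = -2 * u3"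
      using f(3) f'(3) signs(3) by auto
    moreover have "w1 = u1 \<and> w2 = u2 \<and> w3 = -u3 \<or> w1 = -u1 \<and> w2 = -u2 \<and> w3 = u3"
      using 3(3) by (rule opposite)
    ultimately show ?thesis
    proof (cases, goal_cases)
      case 1
      then show ?case by (intro collision[of p h l p' h l]) (use ne f' f2 in auto)
    next
      case 2
      from 2(1) show ?case
      proof
        assume "w1 = u1 \<and> w2 = u2 \<and> w3 = -u3"
        then show ?thesis
          by (intro collision[of p h l' p' h' l]) (use ne f' f2 2 u w in auto)
      next
        assume "w1 = -u1 \<and> w2 = -u2 \<and> w3 = u3"
        then show ?thesis
          by (intro collision[of p h l p' h' l']) (use ne f' f2 2 u w in auto)
      qed
    next
      case 3
      from 3(1) show ?case
      proof
        assume "w1 = u1 \<and> w2 = u2 \<and> w3 = -u3"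
        then show ?thesis
          by (intro collision[of p h' l p' h l']) (use ne f' f2 3 u w in auto)
      next
        assume "w1 = -u1 \<and> w2 = -u2 \<and> w3 = u3"
        then show ?thesis
          by (intro collision[of p h' l' p' h l]) (use ne f' f2 3 u w in auto)
      qed
    qed
  qed
qed

section \<open>Lower bound for products of bipartite graphs\<close>

locale triple_product =
  G: bipartite_distance G d + H1: bipartite_distance H1 e1 + H2: bipartite_distance H2 e2
  for G :: "'a pair_pre_digraph" and d and H1 :: "'b pair_pre_digraph" and e1
    and H2 :: "'c pair_pre_digraph" and e2 +
  assumes two_neighbours: "g \<in> pverts G \<Longrightarrow> \<exists>p p'. p \<noteq> p' \<and> (g, p) \<in> parcs G \<and> (g, p') \<in> parcs G"
    and arc1: "parcs H1 \<noteq> {}" and arc2: "parcs H2 \<noteq> {}"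
begin

abbreviation dist3 :: "('a \<times> 'b) \<times> 'c \<Rightarrow> ('a \<times> 'b) \<times> 'c \<Rightarrow> nat" where
  "dist3 \<equiv> \<lambda>(x, c) (x', c'). (case x of (a, b) \<Rightarrow> \<lambda>(a', b'). d a a' + e1 b b') x' + e2 c c'"

sublocale GHH: bipartite_distance "G \<box> H1 \<box> H2" dist3
  by (intro bipartite_distance_cartesian_product G.bipartite_distance_axioms
      H1.bipartite_distance_axioms H2.bipartite_distance_axioms)

lemma three_vertices_unresolved:
  assumes q: "q1 \<in> pverts (G \<box> H1 \<box> H2)" "q2 \<in> pverts (G \<box> H1 \<box> H2)"
    "q3 \<in> pverts (G \<box> H1 \<box> H2)"
  shows "\<exists>x\<in>pverts (G \<box> H1 \<box> H2). \<exists>y\<in>pverts (G \<box> H1 \<box> H2). x \<noteq> y \<and>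
    dist3 x q1 = dist3 y q1 \<and> dist3 x q2 = dist3 y q2 \<and> dist3 x q3 = dist3 y q3"
proof -
  obtain h h' where h: "(h, h') \<in> parcs H1" using arc1 by auto
  obtain l l' where l: "(l, l') \<in> parcs H2" using arc2 by auto
  define u where "u q = int (e1 h' (snd (fst q))) - int (e1 h (snd (fst q)))"
    for q :: "('a \<times> 'b) \<times> 'c"
  define w where "w q = int (e2 l' (snd q)) - int (e2 l (snd q))" for q :: "('a \<times> 'b) \<times> 'c"
  have u: "u q \<in> {1, -1}" and w: "w q \<in> {1, -1}" if "q \<in> pverts (G \<box> H1 \<box> H2)" for q
    using that H1.dist_arc[OF h, of "snd (fst q)"] H2.dist_arc[OF l, of "snd q"]
    by (auto simp: u_def w_def cartesian_product_def)
  have unresolved: "\<exists>x\<in>pverts (G \<box> H1 \<box> H2). \<exists>y\<in>pverts (G \<box> H1 \<box> H2). x \<noteq> y \<and>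
      dist3 x r1 = dist3 y r1 \<and> dist3 x r2 = dist3 y r2 \<and> dist3 x r3 = dist3 y r3"
    if r: "r1 \<in> pverts (G \<box> H1 \<box> H2)" "r2 \<in> pverts (G \<box> H1 \<box> H2)" "r3 \<in> pverts (G \<box> H1 \<box> H2)"
      and uw: "u r1 * u r2 = w r1 * w r2" for r1 r2 r3
  proof -
    obtain a1 b1 c1 a2 b2 c2 a3 b3 c3
      where eq: "r1 = ((a1, b1), c1)" "r2 = ((a2, b2), c2)" "r3 = ((a3, b3), c3)"
      by (metis surj_pair)
    have a: "a1 \<in> pverts G" "a2 \<in> pverts G" "a3 \<in> pverts G"
      using r eq by (auto simp: cartesian_product_def)
    obtain p p' where p: "p \<noteq> p'" "(a1, p) \<in> parcs G" "(a1, p') \<in> parcs G"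
      using two_neighbours a by blast
    have V: "p \<in> pverts G" "p' \<in> pverts G" "h \<in> pverts H1" "h' \<in> pverts H1"
      "l \<in> pverts H2" "l' \<in> pverts H2"
      using p h l by (auto dest: G.wellformed' H1.wellformed' H2.wellformed')
    have ne: "p \<noteq> a1" "p' \<noteq> a1" "h \<noteq> h'" "l \<noteq> l'"
      using p h l G.no_loops' H1.no_loops' H2.no_loops' by auto
    have steps: "int (d r b) - int (d a1 b) \<in> {1, -1}" if "(a1, r) \<in> parcs G" "b \<in> pverts G" for r b
      using G.dist_arc[OF that] by auto
    note u_eq = u_def[of r1, unfolded eq fst_conv snd_conv] u_def[of r2, unfolded eq fst_conv snd_conv]
      u_def[of r3, unfolded eq fst_conv snd_conv]
    note w_eq = w_def[of r1, unfolded eq snd_conv] w_def[of r2, unfolded eq snd_conv]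
      w_def[of r3, unfolded eq snd_conv]
    let ?S = "{a1, p, p'} \<times> {h, h'} \<times> {l, l'}"
    let ?same = "\<lambda>x x'. x \<noteq> x' \<and> (\<forall>(f, y, z)\<in>{
      (\<lambda>x. int (d x a1), \<lambda>x. int (e1 x b1), \<lambda>x. int (e2 x c1)),
      (\<lambda>x. int (d x a2), \<lambda>x. int (e1 x b2), \<lambda>x. int (e2 x c2)),
      (\<lambda>x. int (d x a3), \<lambda>x. int (e1 x b3), \<lambda>x. int (e2 x c3))}.
        f (fst x) + y (fst (snd x)) + z (snd (snd x)) =
        f (fst x') + y (fst (snd x')) + z (snd (snd x')))"
    have "\<exists>x\<in>?S. \<exists>x'\<in>?S. ?same x x'"
    proof (rule unresolved_if_two_signs_agree)
      \<comment> \<open>From distance 0 an arc can only lead to distance 1, so both neighbours of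
        \<open>a1\<close> are equally far from it.\<close>
      have "d a1 a1 = 0" using a by (simp add: G.dist_eq_0_iff)
      then show "int (d p' a1) = int (d p a1)"
        using G.dist_arc[OF p(2), of a1] G.dist_arc[OF p(3), of a1] a by auto
    qed (rule p ne steps a r[THEN u, unfolded eq u_eq] r[THEN w, unfolded eq w_eq]
        uw[unfolded eq u_eq w_eq])+
    then obtain x where x: "x \<in> ?S" and "\<exists>x'\<in>?S. ?same x x'"
      by (rule bexE)
    from this(2) obtain x' where x': "x' \<in> ?S" and same: "?same x x'"
      by (rule bexE)
    obtain a b c a' b' c' where abc: "x = (a, b, c)" "x' = (a', b', c')" by (metis surj_pair)
    have "int (d a a1) + int (e1 b b1) + int (e2 c c1) = int (d a' a1) + int (e1 b' b1) + int (e2 c' c1)"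
      "int (d a a2) + int (e1 b b2) + int (e2 c c2) = int (d a' a2) + int (e1 b' b2) + int (e2 c' c2)"
      "int (d a a3) + int (e1 b b3) + int (e2 c c3) = int (d a' a3) + int (e1 b' b3) + int (e2 c' c3)"
      using same by (simp_all add: abc)
    then have "dist3 ((a, b), c) r1 = dist3 ((a', b'), c') r1"
      "dist3 ((a, b), c) r2 = dist3 ((a', b'), c') r2"
      "dist3 ((a, b), c) r3 = dist3 ((a', b'), c') r3"
      unfolding eq prod.case of_nat_add[symmetric] of_nat_eq_iff by (simp_all only:)
    moreover have S: "?S \<subseteq> pverts G \<times> pverts H1 \<times> pverts H2" using a V by simp
    have "((a, b), c) \<in> pverts (G \<box> H1 \<box> H2)" "((a', b'), c') \<in> pverts (G \<box> H1 \<box> H2)"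
      using subsetD[OF S x] subsetD[OF S x'] by (simp_all add: abc cartesian_product_def)
    moreover have "((a, b), c) \<noteq> ((a', b'), c')" using same abc by simp
    ultimately show ?thesis by blast
  qed
  \<comment> \<open>The sign relating \<open>w r\<close> to \<open>u r\<close> takes two values on
    three vertices, so it repeats; a pair with the same sign is moved to the front.\<close>
  have "w r = u r \<or> w r = - u r" if "r \<in> pverts (G \<box> H1 \<box> H2)" for r
    using u[OF that] w[OF that] by auto
  note this[OF q(1)] this[OF q(2)] this[OF q(3)]
  then have "u q1 * u q2 = w q1 * w q2 \<or> u q1 * u q3 = w q1 * w q3 \<or> u q2 * u q3 = w q2 * w q3"
    by (elim disjE) simp_all
  then consider "u q1 * u q2 = w q1 * w q2" | "u q1 * u q3 = w q1 * w q3" | "u q2 * u q3 = w q2 * w q3"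
    by blast
  then show ?thesis
  proof cases
    case 1
    then show ?thesis using unresolved q by blast
  next
    case 2
    then show ?thesis using unresolved[of q1 q3 q2] q by blast
  next
    case 3
    then show ?thesis using unresolved[of q2 q3 q1] q by blast
  qed
qed

lemma length_resolving_ge_4:
  assumes "resolving_set (G \<box> H1 \<box> H2) Q" and ne: "pverts G \<noteq> {}"
  shows "length Q \<ge> 4"
proof (rule ccontr)
  assume "\<not> length Q \<ge> 4"
  then have "length Q \<le> 3" by simp
  have Q: "set Q \<subseteq> pverts (G \<box> H1 \<box> H2)" using assms by (simp add: resolving_set_def)
  obtain v where v: "v \<in> pverts (G \<box> H1 \<box> H2)"
    using ne arc1 arc2 H1.wellformed' H2.wellformed' by (fastforce simp: cartesian_product_def)
  \<comment> \<open>Shorter lists are padded to three vertices with an arbitrary \<open>v\<close>: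
    an additional vertex only makes it harder for a pair to stay unresolved.\<close>
  define q where "q i = (if i < length Q then Q ! i else v)" for i
  have q: "q i \<in> pverts (G \<box> H1 \<box> H2)" for i using Q v by (auto simp: q_def)
  obtain x y where xy: "x \<in> pverts (G \<box> H1 \<box> H2)" "y \<in> pverts (G \<box> H1 \<box> H2)" "x \<noteq> y"
    "dist3 x (q 0) = dist3 y (q 0)" "dist3 x (q 1) = dist3 y (q 1)" "dist3 x (q 2) = dist3 y (q 2)"
    using three_vertices_unresolved[OF q q q] by blast
  have "dist3 x (Q ! i) = dist3 y (Q ! i)" if i: "i < length Q" for i
  proof -
    consider "i = 0" | "i = 1" | "i = 2" using i \<open>length Q \<le> 3\<close> by linarith
    then have "dist3 x (q i) = dist3 y (q i)" using xy(4-6) by cases simp_all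
    then show ?thesis using i by (simp add: q_def)
  qed
  then have "\<forall>r\<in>set Q. dist3 x r = dist3 y r" by (metis in_set_conv_nth)
  then have "representation (G \<box> H1 \<box> H2) x Q = representation (G \<box> H1 \<box> H2) y Q"
    using GHH.representation_eq_iff xy Q by blast
  then show False using assms xy by (auto simp: resolving_set_def)
qed

end

section \<open>Even cycles and paths\<close>

text \<open>At most one of the two truncated differences is nonzero, so their sum is \<open>\<bar>i - j\<bar>\<close>.\<close>

definition path_dist :: "nat \<Rightarrow> nat \<Rightarrow> nat" where
  "path_dist i j = (i - j) + (j - i)"

definition cycle_dist :: "nat \<Rightarrow> nat \<Rightarrow> nat \<Rightarrow> nat" where
  "cycle_dist n i j = min (path_dist i j) (n - path_dist i j)"

text \<open>The identity min(t, 2h - t) = h - |h - t| replaces \<open>min\<close> and truncated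
  subtraction by nested absolute values over the integers.\<close>

lemma int_cycle_dist:
  assumes "i < 2 * h" "j < 2 * h"
  shows "int (cycle_dist (2 * h) i j) = int h - \<bar>int h - \<bar>int i - int j\<bar>\<bar>"
proof (cases "i \<le> j")
  case True
  then show ?thesis using assms by (simp add: cycle_dist_def path_dist_def min_def)
next
  case False
  then show ?thesis using assms by (simp add: cycle_dist_def path_dist_def min_def)
qed

text \<open>Absolute values of consecutive integers differ by exactly one. Evenness of the length 2h
  enters by placing the fold of the outer absolute value at the integer \<open>h\<close>. The second
  disjunct of the last assumption is the arc closing the cycle.\<close>

lemma circular_step:
  fixes u v w h :: int
  assumes "0 \<le> u" "0 \<le> v" "0 \<le> w" "u < 2 * h" "v < 2 * h" "w < 2 * h"
    and "v = u + 1 \<or> v = 0 \<and> u = 2 * h - 1"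
  shows "\<bar>h - \<bar>u - w\<bar>\<bar> = \<bar>h - \<bar>v - w\<bar>\<bar> + 1 \<or> \<bar>h - \<bar>v - w\<bar>\<bar> = \<bar>h - \<bar>u - w\<bar>\<bar> + 1"
  using assms(7)
proof
  assume "v = u + 1"
  then show ?thesis by linarith
next
  assume vu: "v = 0 \<and> u = 2 * h - 1"
  then have "\<bar>v - w\<bar> = w" "\<bar>u - w\<bar> = 2 * h - 1 - w" using assms(3,6) by auto
  then show ?thesis by (cases "w < h") simp_all
qed

text \<open>The compared quantity is \<open>h\<close> minus the cyclic distance, so coming closer
  increases it. If u and w differ by at most \<open>h\<close>, step straight towards w; otherwise
  step away from it, crossing between 2h - 1 and 0 when u is at that end.\<close>

lemma circular_closer:
  fixes u w h :: int
  assumes uw: "0 \<le> u" "0 \<le> w" "u < 2 * h" "w < 2 * h" and ne: "u \<noteq> w"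
  shows "\<exists>v. 0 \<le> v \<and> v < 2 * h \<and>
    (v = u + 1 \<or> u = v + 1 \<or> v = 0 \<and> u = 2 * h - 1 \<or> u = 0 \<and> v = 2 * h - 1) \<and>
    \<bar>h - \<bar>v - w\<bar>\<bar> = \<bar>h - \<bar>u - w\<bar>\<bar> + 1" (is "\<exists>v. ?closer v")
proof -
  consider "u < w" "w - u \<le> h" | "w < u" "u - w \<le> h" | "h < w - u" "0 < u" | "h < w - u" "u = 0"
    | "h < u - w" "u < 2 * h - 1" | "h < u - w" "u = 2 * h - 1"
    using uw ne by linarith
  then show ?thesis
  proof cases
    case 1
    then have "?closer (u + 1)" using uw by auto
    then show ?thesis ..
  next
    case 2
    then have "?closer (u - 1)" using uw by auto
    then show ?thesis ..
  next
    case 3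
    then have "?closer (u - 1)" using uw by auto
    then show ?thesis ..
  next
    case 4
    then have "?closer (2 * h - 1)" using uw by auto
    then show ?thesis ..
  next
    case 5
    then have "?closer (u + 1)" using uw by auto
    then show ?thesis ..
  next
    case 6
    then have "?closer 0" using uw by auto
    then show ?thesis ..
  qed
qed

lemma bipartite_distance_path: "bipartite_distance (path_graph k) path_dist"
proof -
  interpret pair_graph "path_graph k" by (rule pair_graph_path_graph)
  show ?thesis
  proof unfold_locales
    fix u w assume "u \<in> pverts (path_graph k)" "w \<in> pverts (path_graph k)" "u \<noteq> w"
    then show "\<exists>v. (u, v) \<in> parcs (path_graph k) \<and> path_dist u w = Suc (path_dist v w)"
      by (intro exI[of _ "if u < w then u + 1 else u - 1"])
        (auto simp: path_graph_def path_dist_def)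
  qed (auto simp: path_graph_def path_dist_def)
qed

lemma cycle_arc_iff:
  assumes "n \<ge> 2"
  shows "(i, j) \<in> parcs (cycle_graph n) \<longleftrightarrow> i < n \<and> j < n \<and>
    (j = i + 1 \<or> i = j + 1 \<or> i = 0 \<and> j = n - 1 \<or> j = 0 \<and> i = n - 1)"
proof -
  have "(l + 1) mod n = (if l = n - 1 then 0 else l + 1)" if "l < n" for l
    using that assms by auto
  then show ?thesis using assms by (auto simp: cycle_graph_def split: if_splits)
qed

lemma bipartite_distance_cycle:
  assumes "n \<ge> 4" "even n"
  shows "bipartite_distance (cycle_graph n) (cycle_dist n)"
proof -
  interpret pair_graph "cycle_graph n" using assms by (intro pair_graph_cycle_graph) simp
  obtain h where h: "n = 2 * h" using \<open>even n\<close> by blast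
  have n: "n \<ge> 2" using assms by simp
  have V: "pverts (cycle_graph n) = {..<n}" by (simp add: cycle_graph_def)
  show ?thesis
  proof unfold_locales
    fix u v assume "u \<in> pverts (cycle_graph n)" "v \<in> pverts (cycle_graph n)"
    then show "cycle_dist n u v = 0 \<longleftrightarrow> u = v"
      by (auto simp: V cycle_dist_def path_dist_def)
  next
    fix u v w assume uv: "(u, v) \<in> parcs (cycle_graph n)" and w: "w \<in> pverts (cycle_graph n)"
    then have less: "u < 2 * h" "v < 2 * h" "w < 2 * h" by (auto simp: V cycle_arc_iff[OF n] simp flip: h)
    have "v = u + 1 \<or> u = v + 1 \<or> u = 0 \<and> v = n - 1 \<or> v = 0 \<and> u = n - 1"
      using uv by (simp add: cycle_arc_iff[OF n])
    \<comment> \<open>\<open>circular_step\<close> covers one orientation of the cycle, so arcs are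
      split by direction.\<close>
    then consider "int v = int u + 1 \<or> int v = 0 \<and> int u = 2 * int h - 1"
      | "int u = int v + 1 \<or> int u = 0 \<and> int v = 2 * int h - 1"
      using n h by fastforce
    then have "int (cycle_dist n u w) = int (cycle_dist n v w) + 1 \<or>
        int (cycle_dist n v w) = int (cycle_dist n u w) + 1"
    proof cases
      case 1
      have "\<bar>int h - \<bar>int u - int w\<bar>\<bar> = \<bar>int h - \<bar>int v - int w\<bar>\<bar> + 1 \<or>
          \<bar>int h - \<bar>int v - int w\<bar>\<bar> = \<bar>int h - \<bar>int u - int w\<bar>\<bar> + 1"
        by (rule circular_step) (use less 1 in simp_all)
      then show ?thesis
        unfolding h int_cycle_dist[OF less(1,3)] int_cycle_dist[OF less(2,3)]
        by (elim disjE) simp_all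
    next
      case 2
      have "\<bar>int h - \<bar>int v - int w\<bar>\<bar> = \<bar>int h - \<bar>int u - int w\<bar>\<bar> + 1 \<or>
          \<bar>int h - \<bar>int u - int w\<bar>\<bar> = \<bar>int h - \<bar>int v - int w\<bar>\<bar> + 1"
        by (rule circular_step) (use less 2 in simp_all)
      then show ?thesis
        unfolding h int_cycle_dist[OF less(1,3)] int_cycle_dist[OF less(2,3)]
        by (elim disjE) simp_all
    qed
    then show "cycle_dist n u w = Suc (cycle_dist n v w) \<or> cycle_dist n v w = Suc (cycle_dist n u w)"
      by linarith
  next
    fix u w assume "u \<in> pverts (cycle_graph n)" "w \<in> pverts (cycle_graph n)" "u \<noteq> w"
    then have less: "u < 2 * h" "w < 2 * h" and "u \<noteq> w" by (simp_all add: V flip: h)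
    then obtain i where i: "0 \<le> i" "i < 2 * int h"
      "i = int u + 1 \<or> int u = i + 1 \<or> i = 0 \<and> int u = 2 * int h - 1 \<or>
        int u = 0 \<and> i = 2 * int h - 1"
      "\<bar>int h - \<bar>i - int w\<bar>\<bar> = \<bar>int h - \<bar>int u - int w\<bar>\<bar> + 1"
      using circular_closer[of "int u" "int w" "int h"] by auto
    from i(1) obtain v where v: "i = int v" using nonneg_int_cases by blast
    have vh: "v < 2 * h" using i(2) v by simp
    have "(u, v) \<in> parcs (cycle_graph n)"
      using i(3) vh less unfolding cycle_arc_iff[OF n] unfolding v h by linarith
    moreover have "int (cycle_dist n u w) = int (cycle_dist n v w) + 1"
      using i(4) unfolding h int_cycle_dist[OF less] int_cycle_dist[OF vh less(2)] v by simp
    then have "cycle_dist n u w = Suc (cycle_dist n v w)" by linarith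
    ultimately show "\<exists>v. (u, v) \<in> parcs (cycle_graph n) \<and> cycle_dist n u w = Suc (cycle_dist n v w)"
      by blast
  qed
qed

text \<open>The distance to 0 fixes a vertex up to the reflection taking x to 2h - x. The distance
  to 1 separates x from its mirror image unless x = h, which is its own image.\<close>

lemma cycle_dist_0_1_inj:
  assumes "even n" "x < n" "y < n"
    and "cycle_dist n x 0 = cycle_dist n y 0" "cycle_dist n x 1 = cycle_dist n y 1"
  shows "x = y"
proof -
  obtain h where h: "n = 2 * h" using \<open>even n\<close> by blast
  then have "h > 0" using assms(2) by simp
  then have less: "x < 2 * h" "y < 2 * h" "0 < 2 * h" "1 < 2 * h" using assms(2,3) h by linarith+
  have "\<bar>int h - int x\<bar> = \<bar>int h - int y\<bar>"
    using assms(4) int_cycle_dist[OF less(1,3)] int_cycle_dist[OF less(2,3)] by (simp add: h)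
  then consider "x = y" | "int y = 2 * int h - int x" by linarith
  then show ?thesis
  proof cases
    case 2
    \<comment> \<open>As x and y are below 2h and sum to 2h, both are at least 1.\<close>
    then have "\<bar>int x - 1\<bar> = int x - 1" "\<bar>int y - 1\<bar> = int y - 1" using less by linarith+
    then have "\<bar>int h - (int x - 1)\<bar> = \<bar>int h - (int y - 1)\<bar>"
      using assms(5) int_cycle_dist[OF less(1,4)] int_cycle_dist[OF less(2,4)] by (simp add: h)
    then show ?thesis using 2 by linarith
  qed
qed

section \<open>Four vertices that resolve the product\<close>

theorem theorem3p9:
  fixes n k m :: nat
  assumes "n \<ge> 4" and "even n" and "k \<ge> 3" and "m \<ge> 2"
  shows "metric_dimension ((cycle_graph n \<box> path_graph k) \<box> path_graph m) = 4"
proof -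
  have n: "n \<ge> 2" using assms by simp
  interpret triple_product "cycle_graph n" "cycle_dist n" "path_graph k" path_dist
    "path_graph m" path_dist
  proof (intro triple_product.intro triple_product_axioms.intro)
    fix g assume "g \<in> pverts (cycle_graph n)"
    then have "g < n" by (simp add: cycle_graph_def)
    then have "(g, if g = n - 1 then 0 else g + 1) \<in> parcs (cycle_graph n)"
      "(g, if g = 0 then n - 1 else g - 1) \<in> parcs (cycle_graph n)"
      "(if g = n - 1 then 0 else g + 1) \<noteq> (if g = 0 then n - 1 else g - 1)"
      using assms by (auto simp: cycle_arc_iff[OF n])
    then show "\<exists>p p'. p \<noteq> p' \<and> (g, p) \<in> parcs (cycle_graph n) \<and> (g, p') \<in> parcs (cycle_graph n)"
      by blast
  next
    have "(0, 1) \<in> parcs (path_graph k)" "(0, 1) \<in> parcs (path_graph m)"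
      using assms by (auto simp: path_graph_def)
    then show "parcs (path_graph k) \<noteq> {}" "parcs (path_graph m) \<noteq> {}" by blast+
  qed (use assms bipartite_distance_cycle bipartite_distance_path in auto)
  let ?G = "cycle_graph n \<box> path_graph k \<box> path_graph m"
  have V: "pverts ?G = ({..<n} \<times> {..<k}) \<times> {..<m}"
    by (simp add: cartesian_product_def cycle_graph_def path_graph_def)
  define Q :: "((nat \<times> nat) \<times> nat) list" where
    "Q = [((0, 0), 0), ((1, 0), 0), ((0, k - 1), 0), ((0, 0), m - 1)]"
  have Q: "set Q \<subseteq> pverts ?G" using assms by (auto simp: Q_def V)
  have "x = y" if xy: "x \<in> pverts ?G" "y \<in> pverts ?G" "representation ?G x Q = representation ?G y Q"
    for x y
  proof -
    obtain a b c a' b' c' where eq: "x = ((a, b), c)" "y = ((a', b'), c')" by (metis surj_pair)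
    have less: "a < n" "b < k" "c < m" "a' < n" "b' < k" "c' < m" using xy eq by (auto simp: V)
    have "\<forall>q\<in>set Q. dist3 x q = dist3 y q" using GHH.representation_eq_iff xy Q by blast
    then have dist: "cycle_dist n a 0 + b + c = cycle_dist n a' 0 + b' + c'"
      "cycle_dist n a 1 + b + c = cycle_dist n a' 1 + b' + c'"
      "cycle_dist n a 0 + (k - 1 - b) + c = cycle_dist n a' 0 + (k - 1 - b') + c'"
      "cycle_dist n a 0 + b + (m - 1 - c) = cycle_dist n a' 0 + b' + (m - 1 - c')"
      using less by (simp_all add: Q_def eq path_dist_def)
    \<comment> \<open>Here t and r are the distances from a path coordinate to the two ends, whose
      sum is the length of the path. The common part s drops out of the difference of the first two
      equations, and t - r together with t + r determines t.\<close>
    have cancel: "t = t'" if "s + t = s' + t'" "s + r = s' + r'" "t + r = t' + r'"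
      for s s' t t' r r' :: nat
      using that by linarith
    have "b = b'"
      by (rule cancel[of "cycle_dist n a 0 + c" _ "cycle_dist n a' 0 + c'" _ "k - 1 - b" "k - 1 - b'"])
        (use dist(1,3) less in \<open>simp_all add: ac_simps\<close>)
    moreover have "c = c'"
      by (rule cancel[of "cycle_dist n a 0 + b" _ "cycle_dist n a' 0 + b'" _ "m - 1 - c" "m - 1 - c'"])
        (use dist(1,4) less in \<open>simp_all add: ac_simps\<close>)
    moreover from calculation have "a = a'"
      by (intro cycle_dist_0_1_inj[OF \<open>even n\<close> less(1,4)]) (use dist(1,2) in simp_all)
    ultimately show ?thesis by (simp add: eq)
  qed
  moreover have "distinct Q" using assms by (auto simp: Q_def)
  ultimately have "resolving_set ?G Q" using Q by (auto simp: resolving_set_def)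
  moreover have "pverts (cycle_graph n) \<noteq> {}" using assms by (simp add: cycle_graph_def lessThan_empty_iff)
  ultimately show ?thesis
    unfolding metric_dimension_def
    by (intro Least_equality) (force simp: Q_def, blast dest: length_resolving_ge_4)
qed

end
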